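(* Let $(H,B,\varphi_{B})$ be a Hopf bracoid in ${\sf C}$ such that $\varphi_{B}\colon H\otimes B\to B$ is a coalgebra morphism. Then $(B,\Phi_{B})$ is a left $H$-module algebra, where $\Phi_{B}= \mu_{B}\circ((\lambda_{B}\circ u_{\varphi_{B}})\otimes\varphi_{B})\circ(\delta_{H}\otimes B)$ and $u_{\varphi_{B}}=\varphi_{B}\circ(H\otimes\eta_{B})$.
   Context: ${\sf C}$ is a strict braided monoidal category with tensor product $\otimes$, unit object $K$ and braiding $c$. For an object $P$ and a morphism $f$, write $P\otimes f$ for $id_P\otimes f$ and $f\otimes P$ for $f\otimes id_P$. Algebras $(A,\eta_A,\mu_A)$, coalgebras $(D,\varepsilon_D,\delta_D)$, and Hopf algebras $X=(X,\eta_X,\mu_X,\varepsilon_X,\delta_X,\lambda_X)$ (with antipode $\lambda_X$) are taken in ${\sf C}$; tensor products have structures $\mu_{A\otimes B}=(\mu_A\otimes\mu_B)\circ(A\otimes c_{B,A}\otimes B)$ and $\delta_{D\otimes E}=(D\otimes c_{D,E}\otimes E)\circ(\delta_D\otimes\delta_E)$, with the obvious units and counits. A Hopf bracoid in ${\sf C}$ is a triple $(H,B,\varphi_B)$ where $H,B$ are Hopf algebras in ${\sf C}$ and $(B,\varphi_B)$ is a left $H$-module such that $$\varphi_{B}\circ(H\otimes\mu_{B})=\mu_{B}\circ (\varphi_{B}\otimes\Phi_{B})\circ(H\otimes c_{H,B}\otimes B)\circ(\delta_{H}\otimes B\otimes B),$$ where $\Phi_{B}= \mu_{B}\circ((\lambda_{B}\circ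 u_{\varphi_{B}})\otimes\varphi_{B})\circ(\delta_{H}\otimes B)$ and $u_{\varphi_{B}}=\varphi_{B}\circ(H\otimes\eta_{B})$. For a Hopf algebra $X$, an algebra $A$ with a left $X$-module structure $\varphi_A$ is a left $X$-module algebra if $\varphi_A\circ(X\otimes\eta_A)=\varepsilon_X\otimes\eta_A$ and $\varphi_A\circ(X\otimes\mu_A)=\mu_A\circ(\varphi_A\otimes\varphi_A)\circ(X\otimes c_{X,A}\otimes A)\circ(\delta_X\otimes A\otimes A)$. *)

theory Defs
  imports Main
begin

section \<open>Strict braided monoidal categories\<close>

record ('o, 'm) braided_data =
  objs    :: "'o set"
  arrs    :: "'m set"
  src     :: "'m \<Rightarrow> 'o"
  tgt     :: "'m \<Rightarrow> 'o"
  ident   :: "'o \<Rightarrow> 'm"  (\<open>\<one>\<index> _\<close> [1000] 999)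
  cmp     :: "'m \<Rightarrow> 'm \<Rightarrow> 'm"  (infixr \<open>\<cdot>\<index>\<close> 60)
  unit_ob :: "'o"  (\<open>\<K>\<index>\<close>)
  tens_ob :: "'o \<Rightarrow> 'o \<Rightarrow> 'o"  (infixr \<open>\<odot>\<index>\<close> 70)
  tens    :: "'m \<Rightarrow> 'm \<Rightarrow> 'm"  (infixr \<open>\<otimes>\<index>\<close> 70)
  braid   :: "'o \<Rightarrow> 'o \<Rightarrow> 'm"

text \<open>
  Composition is in diagrammatic-reverse order, i.e. \<open>g \<cdot> f\<close> is \<open>g\<close> after \<open>f\<close>, and is only
  constrained on composable pairs.  \<open>\<one> P\<close> is the identity of \<open>P\<close>, \<open>\<odot>\<close> is the tensor product
  of objects and \<open>\<otimes>\<close> that of morphisms, so that \<open>\<one> P \<otimes> f\<close> is the whiskering usually written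
  \<open>P \<otimes> f\<close>.
\<close>

definition hom :: "('o, 'm, 'z) braided_data_scheme \<Rightarrow> 'o \<Rightarrow> 'o \<Rightarrow> 'm set"
  where "hom C A B = {f \<in> arrs C. src C f = A \<and> tgt C f = B}"

locale category =
  fixes C :: "('o, 'm, 'z) braided_data_scheme" (structure)
  assumes src_in: "f \<in> arrs C \<Longrightarrow> src C f \<in> objs C"
    and tgt_in: "f \<in> arrs C \<Longrightarrow> tgt C f \<in> objs C"
    and ident_in: "A \<in> objs C \<Longrightarrow> \<one> A \<in> hom C A A"
    and cmp_in: "f \<in> hom C A B \<Longrightarrow> g \<in> hom C B D \<Longrightarrow> g \<cdot> f \<in> hom C A D"
    and ident_left: "f \<in> hom C A B \<Longrightarrow> \<one> B \<cdot> f = f"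
    and ident_right: "f \<in> hom C A B \<Longrightarrow> f \<cdot> \<one> A = f"
    and cmp_assoc:
      "f \<in> hom C A B \<Longrightarrow> g \<in> hom C B D \<Longrightarrow> h \<in> hom C D E \<Longrightarrow> (h \<cdot> g) \<cdot> f = h \<cdot> (g \<cdot> f)"

locale strict_monoidal_category = category +
  assumes unit_ob_in: "\<K> \<in> objs C"
    and tens_ob_in: "A \<in> objs C \<Longrightarrow> B \<in> objs C \<Longrightarrow> A \<odot> B \<in> objs C"
    and tens_in: "f \<in> hom C A A' \<Longrightarrow> g \<in> hom C B B' \<Longrightarrow> f \<otimes> g \<in> hom C (A \<odot> B) (A' \<odot> B')"
    and tens_ident: "A \<in> objs C \<Longrightarrow> B \<in> objs C \<Longrightarrow> \<one> A \<otimes> \<one> B = \<one> (A \<odot> B)"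
    and interchange:
      "f \<in> hom C A A' \<Longrightarrow> f' \<in> hom C A' A'' \<Longrightarrow> g \<in> hom C B B' \<Longrightarrow> g' \<in> hom C B' B'' \<Longrightarrow>
        (f' \<cdot> f) \<otimes> (g' \<cdot> g) = (f' \<otimes> g') \<cdot> (f \<otimes> g)"
    and tens_ob_assoc:
      "A \<in> objs C \<Longrightarrow> B \<in> objs C \<Longrightarrow> D \<in> objs C \<Longrightarrow> (A \<odot> B) \<odot> D = A \<odot> (B \<odot> D)"
    and tens_ob_unit_left: "A \<in> objs C \<Longrightarrow> \<K> \<odot> A = A"
    and tens_ob_unit_right: "A \<in> objs C \<Longrightarrow> A \<odot> \<K> = A"
    and tens_assoc:
      "f \<in> arrs C \<Longrightarrow> g \<in> arrs C \<Longrightarrow> h \<in> arrs C \<Longrightarrow> (f \<otimes> g) \<otimes> h = f \<otimes> (g \<otimes> h)"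
    and tens_unit_left: "f \<in> arrs C \<Longrightarrow> \<one> \<K> \<otimes> f = f"
    and tens_unit_right: "f \<in> arrs C \<Longrightarrow> f \<otimes> \<one> \<K> = f"

locale strict_braided_monoidal_category = strict_monoidal_category +
  assumes braid_in: "A \<in> objs C \<Longrightarrow> B \<in> objs C \<Longrightarrow> braid C A B \<in> hom C (A \<odot> B) (B \<odot> A)"
    and braid_iso:
      "A \<in> objs C \<Longrightarrow> B \<in> objs C \<Longrightarrow>
        \<exists>d \<in> hom C (B \<odot> A) (A \<odot> B).
          d \<cdot> braid C A B = \<one> (A \<odot> B) \<and> braid C A B \<cdot> d = \<one> (B \<odot> A)"
    and braid_natural:
      "f \<in> hom C A A' \<Longrightarrow> g \<in> hom C B B' \<Longrightarrow>
        braid C A' B' \<cdot> (f \<otimes> g) = (g \<otimes> f) \<cdot> braid C A B"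
    and hexagon_right:
      "A \<in> objs C \<Longrightarrow> B \<in> objs C \<Longrightarrow> D \<in> objs C \<Longrightarrow>
        braid C A (B \<odot> D) = (\<one> B \<otimes> braid C A D) \<cdot> (braid C A B \<otimes> \<one> D)"
    and hexagon_left:
      "A \<in> objs C \<Longrightarrow> B \<in> objs C \<Longrightarrow> D \<in> objs C \<Longrightarrow>
        braid C (A \<odot> B) D = (braid C A D \<otimes> \<one> B) \<cdot> (\<one> A \<otimes> braid C B D)"


section \<open>Algebras, coalgebras and Hopf algebras\<close>

text \<open>An algebra \<open>(A, \<eta>, \<mu>)\<close>, respectively a coalgebra \<open>(D, \<epsilon>, \<delta>)\<close>, is a triple of this type.\<close>

type_synonym ('o, 'm) triple = "'o \<times> 'm \<times> 'm"

record ('o, 'm) hopf_data =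
  carr     :: "'o"
  unit     :: "'m"
  mult     :: "'m"
  counit   :: "'m"
  comult   :: "'m"
  antipode :: "'m"

definition alg :: "('o, 'm) hopf_data \<Rightarrow> ('o, 'm) triple"
  where "alg X = (carr X, unit X, mult X)"

definition coalg :: "('o, 'm) hopf_data \<Rightarrow> ('o, 'm) triple"
  where "coalg X = (carr X, counit X, comult X)"

context
  fixes C :: "('o, 'm, 'z) braided_data_scheme" (structure)
begin

fun algebra :: "('o, 'm) triple \<Rightarrow> bool" where
  "algebra (A, \<eta>, \<mu>) \<longleftrightarrow>
    A \<in> objs C \<and> \<eta> \<in> hom C \<K> A \<and> \<mu> \<in> hom C (A \<odot> A) A \<and>
    \<mu> \<cdot> (\<eta> \<otimes> \<one> A) = \<one> A \<and> \<mu> \<cdot> (\<one> A \<otimes> \<eta>) = \<one> A \<and>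
    \<mu> \<cdot> (\<mu> \<otimes> \<one> A) = \<mu> \<cdot> (\<one> A \<otimes> \<mu>)"

fun algebra_morphism :: "('o, 'm) triple \<Rightarrow> ('o, 'm) triple \<Rightarrow> 'm \<Rightarrow> bool" where
  "algebra_morphism (A, \<eta>\<^sub>A, \<mu>\<^sub>A) (B, \<eta>\<^sub>B, \<mu>\<^sub>B) f \<longleftrightarrow>
    f \<in> hom C A B \<and> f \<cdot> \<eta>\<^sub>A = \<eta>\<^sub>B \<and> f \<cdot> \<mu>\<^sub>A = \<mu>\<^sub>B \<cdot> (f \<otimes> f)"

definition unit_algebra :: "('o, 'm) triple" where
  "unit_algebra = (\<K>, \<one> \<K>, \<one> \<K>)"

fun tensor_algebra :: "('o, 'm) triple \<Rightarrow> ('o, 'm) triple \<Rightarrow> ('o, 'm) triple" where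
  "tensor_algebra (A, \<eta>\<^sub>A, \<mu>\<^sub>A) (B, \<eta>\<^sub>B, \<mu>\<^sub>B) =
    (A \<odot> B, \<eta>\<^sub>A \<otimes> \<eta>\<^sub>B, (\<mu>\<^sub>A \<otimes> \<mu>\<^sub>B) \<cdot> (\<one> A \<otimes> braid C B A \<otimes> \<one> B))"

fun coalgebra :: "('o, 'm) triple \<Rightarrow> bool" where
  "coalgebra (D, \<epsilon>, \<delta>) \<longleftrightarrow>
    D \<in> objs C \<and> \<epsilon> \<in> hom C D \<K> \<and> \<delta> \<in> hom C D (D \<odot> D) \<and>
    (\<epsilon> \<otimes> \<one> D) \<cdot> \<delta> = \<one> D \<and> (\<one> D \<otimes> \<epsilon>) \<cdot> \<delta> = \<one> D \<and>
    (\<delta> \<otimes> \<one> D) \<cdot> \<delta> = (\<one> D \<otimes> \<delta>) \<cdot> \<delta>"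

fun coalgebra_morphism :: "('o, 'm) triple \<Rightarrow> ('o, 'm) triple \<Rightarrow> 'm \<Rightarrow> bool" where
  "coalgebra_morphism (D, \<epsilon>\<^sub>D, \<delta>\<^sub>D) (E, \<epsilon>\<^sub>E, \<delta>\<^sub>E) f \<longleftrightarrow>
    f \<in> hom C D E \<and> \<epsilon>\<^sub>E \<cdot> f = \<epsilon>\<^sub>D \<and> \<delta>\<^sub>E \<cdot> f = (f \<otimes> f) \<cdot> \<delta>\<^sub>D"

fun tensor_coalgebra :: "('o, 'm) triple \<Rightarrow> ('o, 'm) triple \<Rightarrow> ('o, 'm) triple" where
  "tensor_coalgebra (D, \<epsilon>\<^sub>D, \<delta>\<^sub>D) (E, \<epsilon>\<^sub>E, \<delta>\<^sub>E) =
    (D \<odot> E, \<epsilon>\<^sub>D \<otimes> \<epsilon>\<^sub>E, (\<one> D \<otimes> braid C D E \<otimes> \<one> E) \<cdot> (\<delta>\<^sub>D \<otimes> \<delta>\<^sub>E))"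

definition hopf_algebra :: "('o, 'm) hopf_data \<Rightarrow> bool" where
  "hopf_algebra X \<longleftrightarrow>
    algebra (alg X) \<and> coalgebra (coalg X) \<and>
    algebra_morphism (alg X) unit_algebra (counit X) \<and>
    algebra_morphism (alg X) (tensor_algebra (alg X) (alg X)) (comult X) \<and>
    antipode X \<in> hom C (carr X) (carr X) \<and>
    mult X \<cdot> (\<one> (carr X) \<otimes> antipode X) \<cdot> comult X = unit X \<cdot> counit X \<and>
    mult X \<cdot> (antipode X \<otimes> \<one> (carr X)) \<cdot> comult X = unit X \<cdot> counit X"


section \<open>Modules, module algebras and Hopf bracoids\<close>

definition left_module :: "('o, 'm) hopf_data \<Rightarrow> 'o \<Rightarrow> 'm \<Rightarrow> bool" where
  "left_module X M \<phi> \<longleftrightarrow>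
    M \<in> objs C \<and> \<phi> \<in> hom C (carr X \<odot> M) M \<and>
    \<phi> \<cdot> (unit X \<otimes> \<one> M) = \<one> M \<and>
    \<phi> \<cdot> (\<one> (carr X) \<otimes> \<phi>) = \<phi> \<cdot> (mult X \<otimes> \<one> M)"

fun left_module_algebra :: "('o, 'm) hopf_data \<Rightarrow> ('o, 'm) triple \<Rightarrow> 'm \<Rightarrow> bool" where
  "left_module_algebra X (A, \<eta>, \<mu>) \<phi> \<longleftrightarrow>
    hopf_algebra X \<and> algebra (A, \<eta>, \<mu>) \<and> left_module X A \<phi> \<and>
    \<phi> \<cdot> (\<one> (carr X) \<otimes> \<eta>) = counit X \<otimes> \<eta> \<and>
    \<phi> \<cdot> (\<one> (carr X) \<otimes> \<mu>) =
      \<mu> \<cdot> (\<phi> \<otimes> \<phi>) \<cdot> (\<one> (carr X) \<otimes> braid C (carr X) A \<otimes> \<one> A) \<cdot> (comult X \<otimes> \<one> A \<otimes> \<one> A)"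

definition bracoid_u :: "('o, 'm) hopf_data \<Rightarrow> ('o, 'm) hopf_data \<Rightarrow> 'm \<Rightarrow> 'm" where
  "bracoid_u H B \<phi> = \<phi> \<cdot> (\<one> (carr H) \<otimes> unit B)"

definition bracoid_Phi :: "('o, 'm) hopf_data \<Rightarrow> ('o, 'm) hopf_data \<Rightarrow> 'm \<Rightarrow> 'm" where
  "bracoid_Phi H B \<phi> =
    mult B \<cdot> ((antipode B \<cdot> bracoid_u H B \<phi>) \<otimes> \<phi>) \<cdot> (comult H \<otimes> \<one> (carr B))"

definition hopf_bracoid :: "('o, 'm) hopf_data \<Rightarrow> ('o, 'm) hopf_data \<Rightarrow> 'm \<Rightarrow> bool" where
  "hopf_bracoid H B \<phi> \<longleftrightarrow>
    hopf_algebra H \<and> hopf_algebra B \<and> left_module H (carr B) \<phi> \<and>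
    \<phi> \<cdot> (\<one> (carr H) \<otimes> mult B) =
      mult B \<cdot> (\<phi> \<otimes> bracoid_Phi H B \<phi>) \<cdot>
        (\<one> (carr H) \<otimes> braid C (carr H) (carr B) \<otimes> \<one> (carr B)) \<cdot>
        (comult H \<otimes> \<one> (carr B) \<otimes> \<one> (carr B))"

end

end

theory Submission
  imports Defs
begin

text \<open>
  Write \<open>g * F\<close> for the convolution action of a morphism \<open>g : D \<rightarrow> B\<close> on \<open>F : D \<odot> M \<rightarrow> B\<close>, where
  \<open>D\<close> is a coalgebra.  Since \<open>\<phi>\<close> is a coalgebra morphism, so is \<open>u\<close>; hence \<open>S \<cdot> u\<close> is the convolution
  inverse of \<open>u\<close>, and \<open>\<Phi> = (S \<cdot> u) * \<phi>\<close> is equivalent to \<open>\<phi> = u * \<Phi>\<close>.  The unit laws are then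
  immediate, and multiplicativity of \<open>\<Phi>\<close> is the bracoid identity acted on by \<open>S \<cdot> u\<close>.  For the module
  law, take \<open>D = H \<odot> H\<close>: substituting \<open>\<phi> = u * \<Phi>\<close> into both sides of
  \<open>\<phi> \<cdot> (H \<otimes> \<phi>) = \<phi> \<cdot> (\<mu> \<otimes> B)\<close> gives
  \<open>(u \<cdot> \<mu>) * (\<Phi> \<cdot> (H \<otimes> \<Phi>)) = (u \<cdot> \<mu>) * (\<Phi> \<cdot> (\<mu> \<otimes> B))\<close>, where \<open>u \<cdot> \<mu>\<close>, a coalgebra morphism,
  is convolution invertible and can be cancelled.
\<close>

section \<open>Calculus of strict monoidal diagrams: typing, interchange, braiding with the unit
  object\<close>

lemma hom_iff: "f \<in> hom C A B \<longleftrightarrow> f \<in> arrs C \<and> src C f = A \<and> tgt C f = B"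
  by (simp add: hom_def)

context strict_braided_monoidal_category
begin

text \<open>With \<open>src\<close> and \<open>tgt\<close> in place of \<open>hom\<close>, the
  typing conditions of later laws can be computed by rewriting; strictness brings objects to a
  right-nested form without factors \<open>\<K>\<close>.\<close>

lemma cmp_arr [simp]:
  assumes "f \<in> arrs C" "g \<in> arrs C" "tgt C f = src C g"
  shows "g \<cdot> f \<in> arrs C" "src C (g \<cdot> f) = src C f" "tgt C (g \<cdot> f) = tgt C g"
  using cmp_in[of f "src C f" "tgt C f" g "tgt C g"] assms by (auto simp: hom_iff)

lemma tens_arr [simp]:
  assumes "f \<in> arrs C" "g \<in> arrs C"
  shows "f \<otimes> g \<in> arrs C" "src C (f \<otimes> g) = src C f \<odot> src C g" "tgt C (f \<otimes> g) = tgt C f \<odot> tgt C g"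
  using tens_in[of f "src C f" "tgt C f" g "src C g" "tgt C g"] assms by (auto simp: hom_iff)

lemma ident_arr [simp]:
  assumes "A \<in> objs C"
  shows "\<one> A \<in> arrs C" "src C (\<one> A) = A" "tgt C (\<one> A) = A"
  using ident_in[OF assms] by (auto simp: hom_iff)

lemma braid_arr [simp]:
  assumes "A \<in> objs C" "B \<in> objs C"
  shows "braid C A B \<in> arrs C" "src C (braid C A B) = A \<odot> B" "tgt C (braid C A B) = B \<odot> A"
  using braid_in[OF assms] by (auto simp: hom_iff)

declare src_in [simp] tgt_in [simp] unit_ob_in [simp] tens_ob_in [simp]
  tens_ob_assoc [simp] tens_ob_unit_left [simp] tens_ob_unit_right [simp]
  tens_assoc [simp] tens_unit_left [simp] tens_unit_right [simp]

lemma assoc [simp]: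
  "\<lbrakk>f \<in> arrs C; g \<in> arrs C; h \<in> arrs C; tgt C f = src C g; tgt C g = src C h\<rbrakk>
    \<Longrightarrow> (h \<cdot> g) \<cdot> f = h \<cdot> (g \<cdot> f)"
  using cmp_assoc[of f "src C f" "tgt C f" g "tgt C g" h "tgt C h"] by (simp add: hom_iff)

lemma left_ident [simp]: "\<lbrakk>f \<in> arrs C; tgt C f = B\<rbrakk> \<Longrightarrow> \<one> B \<cdot> f = f"
  using ident_left[of f "src C f" B] by (simp add: hom_iff)

lemma right_ident [simp]: "\<lbrakk>f \<in> arrs C; src C f = A\<rbrakk> \<Longrightarrow> f \<cdot> \<one> A = f"
  using ident_right[of f A "tgt C f"] by (simp add: hom_iff)

text \<open>Interchange is used mainly in this direction, turning stacked tensor products into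
  tensor products of composites, so that two diagrams can be compared strand by strand.\<close>

lemma merge:
  "\<lbrakk>f \<in> arrs C; f' \<in> arrs C; g \<in> arrs C; g' \<in> arrs C; tgt C f = src C f'; tgt C g = src C g'\<rbrakk>
    \<Longrightarrow> (f' \<otimes> g') \<cdot> (f \<otimes> g) = (f' \<cdot> f) \<otimes> (g' \<cdot> g)"
  using interchange[of f "src C f" "tgt C f" f' "tgt C f'" g "src C g" "tgt C g" g' "tgt C g'"]
  by (simp add: hom_iff)

text \<open>Composites are nested to the right, so two adjacent layers usually carry a tail
  \<open>h\<close>, which plain interchange would not match.\<close>

lemma merge_cmp:
  "\<lbrakk>f \<in> arrs C; f' \<in> arrs C; g \<in> arrs C; g' \<in> arrs C; h \<in> arrs C;
    tgt C f = src C f'; tgt C g = src C g'; tgt C h = src C f \<odot> src C g\<rbrakk>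
    \<Longrightarrow> (f' \<otimes> g') \<cdot> (f \<otimes> g) \<cdot> h = ((f' \<cdot> f) \<otimes> (g' \<cdot> g)) \<cdot> h"
  by (simp add: merge flip: assoc)

text \<open>
  Tensor products are kept associated to the right, so a factor facing the first two of three
  factors needs its own interchange rules.
\<close>

lemma merge_left:
  "\<lbrakk>f \<in> arrs C; g \<in> arrs C; k \<in> arrs C; h \<in> arrs C; l \<in> arrs C;
    tgt C h = src C f \<odot> src C g; tgt C l = src C k\<rbrakk>
    \<Longrightarrow> (f \<otimes> g \<otimes> k) \<cdot> (h \<otimes> l) = ((f \<otimes> g) \<cdot> h) \<otimes> (k \<cdot> l)"
  using merge[of h "f \<otimes> g" l k] by simp

lemma merge_left_cmp:
  "\<lbrakk>f \<in> arrs C; g \<in> arrs C; k \<in> arrs C; h \<in> arrs C; l \<in> arrs C; m \<in> arrs C;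
    tgt C h = src C f \<odot> src C g; tgt C l = src C k; tgt C m = src C h \<odot> src C l\<rbrakk>
    \<Longrightarrow> (f \<otimes> g \<otimes> k) \<cdot> (h \<otimes> l) \<cdot> m = (((f \<otimes> g) \<cdot> h) \<otimes> (k \<cdot> l)) \<cdot> m"
  by (simp add: merge_left flip: assoc)

lemma merge_right:
  "\<lbrakk>f \<in> arrs C; g \<in> arrs C; k \<in> arrs C; h \<in> arrs C; l \<in> arrs C;
    src C h = tgt C f \<odot> tgt C g; src C l = tgt C k\<rbrakk>
    \<Longrightarrow> (h \<otimes> l) \<cdot> (f \<otimes> g \<otimes> k) = (h \<cdot> (f \<otimes> g)) \<otimes> (l \<cdot> k)"
  using merge[of "f \<otimes> g" h k l] by simp

lemma merge_right_cmp:
  "\<lbrakk>f \<in> arrs C; g \<in> arrs C; k \<in> arrs C; h \<in> arrs C; l \<in> arrs C; m \<in> arrs C;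
    src C h = tgt C f \<odot> tgt C g; src C l = tgt C k; tgt C m = src C f \<odot> src C g \<odot> src C k\<rbrakk>
    \<Longrightarrow> (h \<otimes> l) \<cdot> (f \<otimes> g \<otimes> k) \<cdot> m = ((h \<cdot> (f \<otimes> g)) \<otimes> (l \<cdot> k)) \<cdot> m"
  by (simp add: merge_right flip: assoc)

text \<open>\<open>merges\<close> splits the identity of a product object into a product of
  identities, which \<open>left_ident\<close> and \<open>right_ident\<close> no longer
  recognise.\<close>

lemma ident_tens_cmp:
  "\<lbrakk>A \<in> objs C; B \<in> objs C; f \<in> arrs C; tgt C f = A \<odot> B\<rbrakk> \<Longrightarrow> (\<one> A \<otimes> \<one> B) \<cdot> f = f"
  "\<lbrakk>A \<in> objs C; B \<in> objs C; f \<in> arrs C; src C f = A \<odot> B\<rbrakk> \<Longrightarrow> f \<cdot> (\<one> A \<otimes> \<one> B) = f"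
  by (simp_all add: tens_ident)

lemmas merges = merge merge_cmp merge_left merge_left_cmp merge_right merge_right_cmp
  ident_tens_cmp tens_ident[symmetric]

text \<open>Interchange in the splitting direction. Both outer factors go into the innermost layer,
  leaving whiskered arrows above it; this unpacks a hexagon placed between two coproducts.\<close>

lemma whisker_cmp:
  assumes "a \<in> arrs C" "b \<in> arrs C" "d \<in> arrs C" "tgt C d = src C b" "tgt C b = src C a"
    and "f \<in> arrs C" "g \<in> arrs C"
  shows "f \<otimes> (a \<cdot> b \<cdot> d) \<otimes> g
    = (\<one> (tgt C f) \<otimes> a \<otimes> \<one> (tgt C g)) \<cdot> (\<one> (tgt C f) \<otimes> b \<otimes> \<one> (tgt C g)) \<cdot> (f \<otimes> d \<otimes> g)"
  using assms by (simp add: merge merge_cmp)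

lemma braid_natural':
  "\<lbrakk>f \<in> arrs C; g \<in> arrs C; src C f = A; src C g = B; tgt C f = A'; tgt C g = B'\<rbrakk>
    \<Longrightarrow> braid C A' B' \<cdot> (f \<otimes> g) = (g \<otimes> f) \<cdot> braid C A B"
  by (rule braid_natural) (simp_all add: hom_iff)

text \<open>The hexagons make these braidings idempotent, and they are invertible.\<close>

lemma braid_unit_right [simp]:
  assumes A: "A \<in> objs C"
  shows "braid C A \<K> = \<one> A"
proof -
  let ?c = "braid C A \<K>"
  have idem: "?c = ?c \<cdot> ?c"
    using hexagon_right[of A \<K> \<K>] A by simp
  obtain d where d: "d \<in> hom C A A" "d \<cdot> ?c = \<one> A"
    using braid_iso[of A \<K>] A by auto
  have "?c = d \<cdot> (?c \<cdot> ?c)"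
    using d A by (simp add: hom_iff flip: assoc)
  then show ?thesis
    using d idem by simp
qed

lemma braid_unit_left [simp]:
  assumes A: "A \<in> objs C"
  shows "braid C \<K> A = \<one> A"
proof -
  let ?c = "braid C \<K> A"
  have idem: "?c = ?c \<cdot> ?c"
    using hexagon_left[of \<K> \<K> A] A by simp
  obtain d where d: "d \<in> hom C A A" "d \<cdot> ?c = \<one> A"
    using braid_iso[of \<K> A] A by auto
  have "?c = d \<cdot> (?c \<cdot> ?c)"
    using d A by (simp add: hom_iff flip: assoc)
  then show ?thesis
    using d idem by simp
qed

section \<open>Tensor products of coalgebras\<close>

text \<open>Naturality and the hexagons move all coproducts below the braidings. Both sides then
  become the same braid \<open>?mid\<close> after the iterated coproducts of the factors, which
  agree by coassociativity in \<open>D\<close> and in \<open>E\<close>.\<close>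

lemma tensor_coalgebra_coassoc:
  assumes D: "coalgebra C (D, \<epsilon>\<^sub>D, \<delta>\<^sub>D)" and E: "coalgebra C (E, \<epsilon>\<^sub>E, \<delta>\<^sub>E)"
  defines "\<Delta> \<equiv> (\<one> D \<otimes> braid C D E \<otimes> \<one> E) \<cdot> (\<delta>\<^sub>D \<otimes> \<delta>\<^sub>E)"
  shows "(\<Delta> \<otimes> \<one> (D \<odot> E)) \<cdot> \<Delta> = (\<one> (D \<odot> E) \<otimes> \<Delta>) \<cdot> \<Delta>"
proof -
  let ?c = "braid C D E"
  have ob [simp]: "D \<in> objs C" "E \<in> objs C"
    and \<delta>D [simp]: "\<delta>\<^sub>D \<in> arrs C" "src C \<delta>\<^sub>D = D" "tgt C \<delta>\<^sub>D = D \<odot> D"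
    and \<delta>E [simp]: "\<delta>\<^sub>E \<in> arrs C" "src C \<delta>\<^sub>E = E" "tgt C \<delta>\<^sub>E = E \<odot> E"
    and coD: "(\<delta>\<^sub>D \<otimes> \<one> D) \<cdot> \<delta>\<^sub>D = (\<one> D \<otimes> \<delta>\<^sub>D) \<cdot> \<delta>\<^sub>D"
    and coE: "(\<delta>\<^sub>E \<otimes> \<one> E) \<cdot> \<delta>\<^sub>E = (\<one> E \<otimes> \<delta>\<^sub>E) \<cdot> \<delta>\<^sub>E"
    using D E by (auto simp: hom_iff)
  \<comment> \<open>The shuffle from \<open>D D D E E E\<close> to \<open>D E D E D E\<close>: one
    inner crossing, then two crossings on disjoint strands.\<close>
  let ?mid = "(\<one> D \<otimes> ?c \<otimes> ?c \<otimes> \<one> E) \<cdot> (\<one> (D \<odot> D) \<otimes> ?c \<otimes> \<one> (E \<odot> E))"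
  have "\<Delta> \<otimes> \<one> (D \<odot> E)
      = (\<one> D \<otimes> ?c \<otimes> \<one> E \<otimes> \<one> (D \<odot> E)) \<cdot> (\<delta>\<^sub>D \<otimes> \<delta>\<^sub>E \<otimes> \<one> D \<otimes> \<one> E)"
    using merge[of "\<delta>\<^sub>D \<otimes> \<delta>\<^sub>E" "\<one> D \<otimes> ?c \<otimes> \<one> E" "\<one> (D \<odot> E)" "\<one> (D \<odot> E)"]
    by (simp add: \<Delta>_def ident_tens_cmp tens_ident[symmetric])
  moreover have "\<one> (D \<odot> E) \<otimes> \<Delta>
      = (\<one> (D \<odot> E) \<otimes> \<one> D \<otimes> ?c \<otimes> \<one> E) \<cdot> (\<one> D \<otimes> \<one> E \<otimes> \<delta>\<^sub>D \<otimes> \<delta>\<^sub>E)"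
    using merge[of "\<one> (D \<odot> E)" "\<one> (D \<odot> E)" "\<delta>\<^sub>D \<otimes> \<delta>\<^sub>E" "\<one> D \<otimes> ?c \<otimes> \<one> E"]
    by (simp add: \<Delta>_def ident_tens_cmp tens_ident[symmetric])
  ultimately have \<Delta>: "\<Delta> \<otimes> \<one> (D \<odot> E)
      = (\<one> D \<otimes> ?c \<otimes> \<one> E \<otimes> \<one> (D \<odot> E)) \<cdot> (\<delta>\<^sub>D \<otimes> \<delta>\<^sub>E \<otimes> \<one> D \<otimes> \<one> E)"
    "\<one> (D \<odot> E) \<otimes> \<Delta>
      = (\<one> (D \<odot> E) \<otimes> \<one> D \<otimes> ?c \<otimes> \<one> E) \<cdot> (\<one> D \<otimes> \<one> E \<otimes> \<delta>\<^sub>D \<otimes> \<delta>\<^sub>E)"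
    by blast+
  have natE: "(\<delta>\<^sub>E \<otimes> \<one> D) \<cdot> ?c = (\<one> E \<otimes> ?c) \<cdot> (?c \<otimes> \<one> E) \<cdot> (\<one> D \<otimes> \<delta>\<^sub>E)"
    using braid_natural'[of "\<one> D" \<delta>\<^sub>E D E D "E \<odot> E"] by (simp add: hexagon_right)
  have natD: "(\<one> E \<otimes> \<delta>\<^sub>D) \<cdot> ?c = (?c \<otimes> \<one> D) \<cdot> (\<one> D \<otimes> ?c) \<cdot> (\<delta>\<^sub>D \<otimes> \<one> E)"
    using braid_natural'[of \<delta>\<^sub>D "\<one> E" D E "D \<odot> D" E] by (simp add: hexagon_left)
  have "(\<Delta> \<otimes> \<one> (D \<odot> E)) \<cdot> \<Delta>
      = (\<one> D \<otimes> ?c \<otimes> \<one> E \<otimes> \<one> (D \<odot> E)) \<cdot> (\<delta>\<^sub>D \<otimes> ((\<delta>\<^sub>E \<otimes> \<one> D) \<cdot> ?c) \<otimes> \<one> E) \<cdot> (\<delta>\<^sub>D \<otimes> \<delta>\<^sub>E)"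
    \<comment> \<open>The whiskered copies of \<open>\<Delta>\<close> must be rewritten before its
      definition is unfolded, since their rules match the folded constant.\<close>
    unfolding \<Delta> unfolding \<Delta>_def by (simp add: merges)
  also have "\<dots> = ?mid \<cdot> (((\<delta>\<^sub>D \<otimes> \<one> D) \<cdot> \<delta>\<^sub>D) \<otimes> ((\<delta>\<^sub>E \<otimes> \<one> E) \<cdot> \<delta>\<^sub>E))"
  proof -
    have "\<delta>\<^sub>D \<otimes> ((\<one> E \<otimes> ?c) \<cdot> (?c \<otimes> \<one> E) \<cdot> (\<one> D \<otimes> \<delta>\<^sub>E)) \<otimes> \<one> E
        = (\<one> (D \<odot> D) \<otimes> \<one> E \<otimes> ?c \<otimes> \<one> E) \<cdot> (\<one> (D \<odot> D) \<otimes> ?c \<otimes> \<one> E \<otimes> \<one> E) \<cdot>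
          (\<delta>\<^sub>D \<otimes> \<one> D \<otimes> \<delta>\<^sub>E \<otimes> \<one> E)"
      by (subst whisker_cmp) simp_all
    \<comment> \<open>Disjoint crossings can be performed in either order: here the right one comes
      first, in the mirror step below the left one.\<close>
    moreover have "\<one> D \<otimes> ?c \<otimes> ?c \<otimes> \<one> E
        = (\<one> D \<otimes> ?c \<otimes> \<one> E \<otimes> \<one> (D \<odot> E)) \<cdot> (\<one> (D \<odot> D) \<otimes> \<one> E \<otimes> ?c \<otimes> \<one> E)"
      by (simp add: merges)
    moreover have "((\<delta>\<^sub>D \<otimes> \<one> D) \<cdot> \<delta>\<^sub>D) \<otimes> ((\<delta>\<^sub>E \<otimes> \<one> E) \<cdot> \<delta>\<^sub>E)
        = (\<delta>\<^sub>D \<otimes> \<one> D \<otimes> \<delta>\<^sub>E \<otimes> \<one> E) \<cdot> (\<delta>\<^sub>D \<otimes> \<delta>\<^sub>E)"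
      by (simp add: merges)
    moreover have "\<one> (D \<odot> D) \<otimes> ?c \<otimes> \<one> (E \<odot> E) = \<one> (D \<odot> D) \<otimes> ?c \<otimes> \<one> E \<otimes> \<one> E"
      by (simp add: tens_ident)
    ultimately show ?thesis
      unfolding natE by simp
  qed
  also have "\<dots> = (\<one> (D \<odot> E) \<otimes> \<one> D \<otimes> ?c \<otimes> \<one> E) \<cdot> (\<one> D \<otimes> ((\<one> E \<otimes> \<delta>\<^sub>D) \<cdot> ?c) \<otimes> \<delta>\<^sub>E) \<cdot> (\<delta>\<^sub>D \<otimes> \<delta>\<^sub>E)"
  proof -
    have "\<one> D \<otimes> ((?c \<otimes> \<one> D) \<cdot> (\<one> D \<otimes> ?c) \<cdot> (\<delta>\<^sub>D \<otimes> \<one> E)) \<otimes> \<delta>\<^sub>E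
        = (\<one> D \<otimes> ?c \<otimes> \<one> D \<otimes> \<one> (E \<odot> E)) \<cdot> (\<one> D \<otimes> \<one> D \<otimes> ?c \<otimes> \<one> (E \<odot> E)) \<cdot>
          (\<one> D \<otimes> \<delta>\<^sub>D \<otimes> \<one> E \<otimes> \<delta>\<^sub>E)"
      by (subst whisker_cmp) simp_all
    moreover have "\<one> D \<otimes> ?c \<otimes> ?c \<otimes> \<one> E
        = (\<one> (D \<odot> E) \<otimes> \<one> D \<otimes> ?c \<otimes> \<one> E) \<cdot> (\<one> D \<otimes> ?c \<otimes> \<one> D \<otimes> \<one> (E \<odot> E))"
      by (simp add: merges)
    moreover have "((\<one> D \<otimes> \<delta>\<^sub>D) \<cdot> \<delta>\<^sub>D) \<otimes> ((\<one> E \<otimes> \<delta>\<^sub>E) \<cdot> \<delta>\<^sub>E)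
        = (\<one> D \<otimes> \<delta>\<^sub>D \<otimes> \<one> E \<otimes> \<delta>\<^sub>E) \<cdot> (\<delta>\<^sub>D \<otimes> \<delta>\<^sub>E)"
      by (simp add: merges)
    moreover have "\<one> (D \<odot> D) \<otimes> ?c \<otimes> \<one> (E \<odot> E) = \<one> D \<otimes> \<one> D \<otimes> ?c \<otimes> \<one> (E \<odot> E)"
      by (simp add: tens_ident[symmetric])
    ultimately show ?thesis
      unfolding natD coD coE by simp
  qed
  also have "\<dots> = (\<one> (D \<odot> E) \<otimes> \<Delta>) \<cdot> \<Delta>"
  proof -
    have "\<one> D \<otimes> ((\<one> E \<otimes> \<delta>\<^sub>D) \<cdot> ?c) \<otimes> \<delta>\<^sub>E = (\<one> D \<otimes> \<one> E \<otimes> \<delta>\<^sub>D \<otimes> \<delta>\<^sub>E) \<cdot> (\<one> D \<otimes> ?c \<otimes> \<one> E)"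
      by (simp add: merges)
    then show ?thesis
      unfolding \<Delta> unfolding \<Delta>_def by simp
  qed
  finally show ?thesis .
qed

text \<open>The counit laws reduce to those of the factors: a counit slides through the braiding by
  naturality and leaves a braiding with \<open>\<K>\<close>, which is an identity.\<close>

lemma tensor_coalgebra_coalgebra:
  assumes D: "coalgebra C X" and E: "coalgebra C Y"
  shows "coalgebra C (tensor_coalgebra C X Y)"
proof -
  obtain D \<epsilon>\<^sub>D \<delta>\<^sub>D where X: "X = (D, \<epsilon>\<^sub>D, \<delta>\<^sub>D)"
    by (cases X)
  obtain E \<epsilon>\<^sub>E \<delta>\<^sub>E where Y: "Y = (E, \<epsilon>\<^sub>E, \<delta>\<^sub>E)"
    by (cases Y)
  let ?c = "braid C D E"
  have ob [simp]: "D \<in> objs C" "E \<in> objs C"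
    and \<delta>D [simp]: "\<delta>\<^sub>D \<in> arrs C" "src C \<delta>\<^sub>D = D" "tgt C \<delta>\<^sub>D = D \<odot> D"
    and \<delta>E [simp]: "\<delta>\<^sub>E \<in> arrs C" "src C \<delta>\<^sub>E = E" "tgt C \<delta>\<^sub>E = E \<odot> E"
    and \<epsilon>D [simp]: "\<epsilon>\<^sub>D \<in> arrs C" "src C \<epsilon>\<^sub>D = D" "tgt C \<epsilon>\<^sub>D = \<K>"
    and \<epsilon>E [simp]: "\<epsilon>\<^sub>E \<in> arrs C" "src C \<epsilon>\<^sub>E = E" "tgt C \<epsilon>\<^sub>E = \<K>"
    and coD: "(\<epsilon>\<^sub>D \<otimes> \<one> D) \<cdot> \<delta>\<^sub>D = \<one> D" "(\<one> D \<otimes> \<epsilon>\<^sub>D) \<cdot> \<delta>\<^sub>D = \<one> D"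
    and coE: "(\<epsilon>\<^sub>E \<otimes> \<one> E) \<cdot> \<delta>\<^sub>E = \<one> E" "(\<one> E \<otimes> \<epsilon>\<^sub>E) \<cdot> \<delta>\<^sub>E = \<one> E"
    using D E by (auto simp: X Y hom_iff)
  have natE: "(\<epsilon>\<^sub>E \<otimes> \<one> D) \<cdot> ?c = \<one> D \<otimes> \<epsilon>\<^sub>E"
    using braid_natural'[of "\<one> D" \<epsilon>\<^sub>E D E D \<K>] by simp
  have natD: "(\<one> E \<otimes> \<epsilon>\<^sub>D) \<cdot> ?c = \<epsilon>\<^sub>D \<otimes> \<one> E"
    using braid_natural'[of \<epsilon>\<^sub>D "\<one> E" D E \<K> E] by simp
  have "(\<epsilon>\<^sub>D \<otimes> \<epsilon>\<^sub>E \<otimes> \<one> (D \<odot> E)) \<cdot> (\<one> D \<otimes> ?c \<otimes> \<one> E) \<cdot> (\<delta>\<^sub>D \<otimes> \<delta>\<^sub>E)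
      = (\<epsilon>\<^sub>D \<otimes> ((\<epsilon>\<^sub>E \<otimes> \<one> D) \<cdot> ?c) \<otimes> \<one> E) \<cdot> (\<delta>\<^sub>D \<otimes> \<delta>\<^sub>E)"
    by (simp add: merges)
  also have "\<dots> = ((\<epsilon>\<^sub>D \<otimes> \<one> D) \<cdot> \<delta>\<^sub>D) \<otimes> ((\<epsilon>\<^sub>E \<otimes> \<one> E) \<cdot> \<delta>\<^sub>E)"
    unfolding natE using merge[of \<delta>\<^sub>D "\<epsilon>\<^sub>D \<otimes> \<one> D" \<delta>\<^sub>E "\<epsilon>\<^sub>E \<otimes> \<one> E"] by simp
  finally have left: "(\<epsilon>\<^sub>D \<otimes> \<epsilon>\<^sub>E \<otimes> \<one> (D \<odot> E)) \<cdot> (\<one> D \<otimes> ?c \<otimes> \<one> E) \<cdot> (\<delta>\<^sub>D \<otimes> \<delta>\<^sub>E)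
      = \<one> (D \<odot> E)"
    unfolding coD coE by (simp add: tens_ident)
  have "(\<one> (D \<odot> E) \<otimes> \<epsilon>\<^sub>D \<otimes> \<epsilon>\<^sub>E) \<cdot> (\<one> D \<otimes> ?c \<otimes> \<one> E) \<cdot> (\<delta>\<^sub>D \<otimes> \<delta>\<^sub>E)
      = (\<one> D \<otimes> ((\<one> E \<otimes> \<epsilon>\<^sub>D) \<cdot> ?c) \<otimes> \<epsilon>\<^sub>E) \<cdot> (\<delta>\<^sub>D \<otimes> \<delta>\<^sub>E)"
    by (simp add: merges)
  also have "\<dots> = ((\<one> D \<otimes> \<epsilon>\<^sub>D) \<cdot> \<delta>\<^sub>D) \<otimes> ((\<one> E \<otimes> \<epsilon>\<^sub>E) \<cdot> \<delta>\<^sub>E)"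
    unfolding natD using merge[of \<delta>\<^sub>D "\<one> D \<otimes> \<epsilon>\<^sub>D" \<delta>\<^sub>E "\<one> E \<otimes> \<epsilon>\<^sub>E"] by simp
  finally have right: "(\<one> (D \<odot> E) \<otimes> \<epsilon>\<^sub>D \<otimes> \<epsilon>\<^sub>E) \<cdot> (\<one> D \<otimes> ?c \<otimes> \<one> E) \<cdot> (\<delta>\<^sub>D \<otimes> \<delta>\<^sub>E)
      = \<one> (D \<odot> E)"
    unfolding coD coE by (simp add: tens_ident)
  show ?thesis
    using left right tensor_coalgebra_coassoc[OF D[unfolded X] E[unfolded Y]]
    by (simp add: X Y hom_iff)
qed

section \<open>Convolution\<close>

text \<open>
  For a coalgebra \<open>D\<close> and an algebra \<open>A\<close> this is the action of the convolution monoid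
  of morphisms \<open>D \<rightarrow> A\<close> on the morphisms \<open>D \<odot> M \<rightarrow> A\<close>.
\<close>

definition conv :: "'b \<Rightarrow> 'b \<Rightarrow> 'a \<Rightarrow> 'b \<Rightarrow> 'b \<Rightarrow> 'b" where
  "conv \<mu> \<delta> M g F = \<mu> \<cdot> (g \<otimes> F) \<cdot> (\<delta> \<otimes> \<one> M)"

text \<open>This is the action axiom, since
  \<open>\<mu> \<cdot> (g' \<otimes> g) \<cdot> \<delta>\<close> is the convolution product of
  \<open>g'\<close> and \<open>g\<close>. Associativity rebrackets the products, coassociativity the
  copies of \<open>D\<close>.\<close>

lemma conv_assoc:
  assumes A: "algebra C (A, \<eta>, \<mu>)" and D: "coalgebra C (D, \<epsilon>, \<delta>)" and M: "M \<in> objs C"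
    and g': "g' \<in> hom C D A" and g: "g \<in> hom C D A" and F: "F \<in> hom C (D \<odot> M) A"
  shows "conv \<mu> \<delta> M g' (conv \<mu> \<delta> M g F) = conv \<mu> \<delta> M (\<mu> \<cdot> (g' \<otimes> g) \<cdot> \<delta>) F"
proof -
  note [simp] = M
  have [simp]: "A \<in> objs C" "D \<in> objs C" "\<mu> \<in> arrs C" "src C \<mu> = A \<odot> A" "tgt C \<mu> = A"
    "\<delta> \<in> arrs C" "src C \<delta> = D" "tgt C \<delta> = D \<odot> D"
    "g \<in> arrs C" "src C g = D" "tgt C g = A" "g' \<in> arrs C" "src C g' = D" "tgt C g' = A"
    "F \<in> arrs C" "src C F = D \<odot> M" "tgt C F = A"
    and assoc_A: "\<mu> \<cdot> (\<mu> \<otimes> \<one> A) = \<mu> \<cdot> (\<one> A \<otimes> \<mu>)"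
    and coassoc: "(\<delta> \<otimes> \<one> D) \<cdot> \<delta> = (\<one> D \<otimes> \<delta>) \<cdot> \<delta>"
    using assms by (auto simp: hom_iff)
  have "g' \<otimes> conv \<mu> \<delta> M g F = (\<one> A \<otimes> \<mu>) \<cdot> (g' \<otimes> g \<otimes> F) \<cdot> (\<one> D \<otimes> \<delta> \<otimes> \<one> M)"
    and "(((\<one> D \<otimes> \<delta>) \<cdot> \<delta>) \<otimes> \<one> M) = (\<one> D \<otimes> \<delta> \<otimes> \<one> M) \<cdot> (\<delta> \<otimes> \<one> M)"
    by (simp_all add: conv_def merges)
  then have "conv \<mu> \<delta> M g' (conv \<mu> \<delta> M g F)
      = (\<mu> \<cdot> (\<one> A \<otimes> \<mu>)) \<cdot> (g' \<otimes> g \<otimes> F) \<cdot> (((\<one> D \<otimes> \<delta>) \<cdot> \<delta>) \<otimes> \<one> M)"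
    \<comment> \<open>Only the outer action is unfolded; the inner one must stay folded to match the
      equation just proved.\<close>
    by (simp add: conv_def[where g = g'])
  also have "\<dots> = (\<mu> \<cdot> (\<mu> \<otimes> \<one> A)) \<cdot> (g' \<otimes> g \<otimes> F) \<cdot> (((\<delta> \<otimes> \<one> D) \<cdot> \<delta>) \<otimes> \<one> M)"
    by (simp only: assoc_A coassoc)
  also have "\<dots> = conv \<mu> \<delta> M (\<mu> \<cdot> (g' \<otimes> g) \<cdot> \<delta>) F"
  proof -
    have "(\<mu> \<cdot> (g' \<otimes> g) \<cdot> \<delta>) \<otimes> F = (\<mu> \<otimes> \<one> A) \<cdot> (g' \<otimes> g \<otimes> F) \<cdot> (\<delta> \<otimes> \<one> D \<otimes> \<one> M)"
      and "((\<delta> \<otimes> \<one> D) \<cdot> \<delta>) \<otimes> \<one> M = (\<delta> \<otimes> \<one> D \<otimes> \<one> M) \<cdot> (\<delta> \<otimes> \<one> M)"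
      by (simp_all add: merges)
    then show ?thesis
      by (simp add: conv_def)
  qed
  finally show ?thesis .
qed

lemma conv_unit:
  assumes A: "algebra C (A, \<eta>, \<mu>)" and D: "coalgebra C (D, \<epsilon>, \<delta>)" and M: "M \<in> objs C"
    and F: "F \<in> hom C (D \<odot> M) A"
  shows "conv \<mu> \<delta> M (\<eta> \<cdot> \<epsilon>) F = F"
proof -
  note [simp] = M
  have [simp]: "A \<in> objs C" "D \<in> objs C" "\<mu> \<in> arrs C" "src C \<mu> = A \<odot> A" "tgt C \<mu> = A"
    "\<delta> \<in> arrs C" "src C \<delta> = D" "tgt C \<delta> = D \<odot> D"
    "\<eta> \<in> arrs C" "src C \<eta> = \<K>" "tgt C \<eta> = A" "\<epsilon> \<in> arrs C" "src C \<epsilon> = D" "tgt C \<epsilon> = \<K>"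
    "F \<in> arrs C" "src C F = D \<odot> M" "tgt C F = A"
    and unit_A: "\<mu> \<cdot> (\<eta> \<otimes> \<one> A) = \<one> A" and counit_D: "(\<epsilon> \<otimes> \<one> D) \<cdot> \<delta> = \<one> D"
    using assms by (auto simp: hom_iff)
  \<comment> \<open>\<open>F\<close> is padded with \<open>\<one> A\<close> so that interchange,
    read backwards, exposes \<open>\<eta> \<otimes> \<one> A\<close> next to
    \<open>\<mu>\<close>.\<close>
  have "conv \<mu> \<delta> M (\<eta> \<cdot> \<epsilon>) F = \<mu> \<cdot> ((\<eta> \<cdot> \<epsilon>) \<otimes> (\<one> A \<cdot> F)) \<cdot> (\<delta> \<otimes> \<one> M)"
    by (simp add: conv_def)
  also have "\<dots> = (\<mu> \<cdot> (\<eta> \<otimes> \<one> A)) \<cdot> (\<epsilon> \<otimes> F) \<cdot> (\<delta> \<otimes> \<one> M)"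
    by (subst merge[symmetric]) simp_all
  also have "\<epsilon> \<otimes> F = F \<cdot> (\<epsilon> \<otimes> \<one> D \<otimes> \<one> M)"
    using merge[of \<epsilon> "\<one> \<K>" "\<one> (D \<odot> M)" F] by (simp add: tens_ident)
  also have "(F \<cdot> (\<epsilon> \<otimes> \<one> D \<otimes> \<one> M)) \<cdot> (\<delta> \<otimes> \<one> M) = F \<cdot> (((\<epsilon> \<otimes> \<one> D) \<cdot> \<delta>) \<otimes> \<one> M)"
    using merge[of \<delta> "\<epsilon> \<otimes> \<one> D" "\<one> M" "\<one> M"] by simp
  finally show ?thesis
    unfolding unit_A counit_D by (simp add: tens_ident)
qed

text \<open>Used twice: with \<open>g' = u\<close> and \<open>g = S \<cdot> u\<close> it recovers
  \<open>\<phi>\<close> from \<open>\<Phi>\<close>; with \<open>g = u \<cdot> mult H\<close> it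
  removes a common factor in the module law.\<close>

lemma conv_cancel:
  assumes A: "algebra C (A, \<eta>, \<mu>)" and D: "coalgebra C (D, \<epsilon>, \<delta>)" and M: "M \<in> objs C"
    and g': "g' \<in> hom C D A" and g: "g \<in> hom C D A"
    and inv: "\<mu> \<cdot> (g' \<otimes> g) \<cdot> \<delta> = \<eta> \<cdot> \<epsilon>"
    and F: "F \<in> hom C (D \<odot> M) A"
  shows "conv \<mu> \<delta> M g' (conv \<mu> \<delta> M g F) = F"
  using conv_assoc[OF A D M g' g F] conv_unit[OF A D M F] inv by simp

text \<open>Base change: comultiplicativity of \<open>f\<close> duplicates it past
  \<open>\<delta>\<close>. It is applied to \<open>unit H\<close>, to restrict to
  \<open>\<K>\<close>, and to \<open>mult H\<close>, to pass to \<open>h \<odot> h\<close>.\<close>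

lemma conv_comp_coalgebra_map:
  assumes A: "algebra C (A, \<eta>, \<mu>)" and D: "coalgebra C (D, \<epsilon>, \<delta>)" and M: "M \<in> objs C"
    and f: "coalgebra_morphism C (E, \<epsilon>\<^sub>E, \<delta>\<^sub>E) (D, \<epsilon>, \<delta>) f" and E: "\<delta>\<^sub>E \<in> hom C E (E \<odot> E)"
    and g: "g \<in> hom C D A" and F: "F \<in> hom C (D \<odot> M) A"
  shows "conv \<mu> \<delta> M g F \<cdot> (f \<otimes> \<one> M) = conv \<mu> \<delta>\<^sub>E M (g \<cdot> f) (F \<cdot> (f \<otimes> \<one> M))"
proof -
  note [simp] = M
  have [simp]: "E \<in> objs C"
    using f src_in[of f] by (auto simp: hom_iff)
  have [simp]: "A \<in> objs C" "D \<in> objs C" "\<mu> \<in> arrs C" "src C \<mu> = A \<odot> A" "tgt C \<mu> = A"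
    "\<delta> \<in> arrs C" "src C \<delta> = D" "tgt C \<delta> = D \<odot> D"
    "\<delta>\<^sub>E \<in> arrs C" "src C \<delta>\<^sub>E = E" "tgt C \<delta>\<^sub>E = E \<odot> E"
    "f \<in> arrs C" "src C f = E" "tgt C f = D" "g \<in> arrs C" "src C g = D" "tgt C g = A"
    "F \<in> arrs C" "src C F = D \<odot> M" "tgt C F = A"
    and comult: "\<delta> \<cdot> f = (f \<otimes> f) \<cdot> \<delta>\<^sub>E"
    using assms by (auto simp: hom_iff)
  have "conv \<mu> \<delta> M g F \<cdot> (f \<otimes> \<one> M) = \<mu> \<cdot> (g \<otimes> F) \<cdot> ((\<delta> \<cdot> f) \<otimes> \<one> M)"
    by (simp add: conv_def merges)
  also have "\<dots> = \<mu> \<cdot> (g \<otimes> F) \<cdot> ((f \<otimes> f \<otimes> \<one> M) \<cdot> (\<delta>\<^sub>E \<otimes> \<one> M))"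
    unfolding comult by (simp add: merges)
  also have "\<dots> = conv \<mu> \<delta>\<^sub>E M (g \<cdot> f) (F \<cdot> (f \<otimes> \<one> M))"
    using merge_cmp[of f g "f \<otimes> \<one> M" F "\<delta>\<^sub>E \<otimes> \<one> M"] by (simp add: conv_def)
  finally show ?thesis .
qed

text \<open>\<open>k\<close> acts on the strand that \<open>\<delta>\<close> leaves alone, so it
  slides past. It is applied to \<open>unit B\<close> and \<open>mult B\<close>.\<close>

lemma conv_comp_right:
  assumes A: "algebra C (A, \<eta>, \<mu>)" and D: "coalgebra C (D, \<epsilon>, \<delta>)" and k: "k \<in> hom C M N"
    and g: "g \<in> hom C D A" and F: "F \<in> hom C (D \<odot> N) A"
  shows "conv \<mu> \<delta> N g F \<cdot> (\<one> D \<otimes> k) = conv \<mu> \<delta> M g (F \<cdot> (\<one> D \<otimes> k))"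
proof -
  have [simp]: "M \<in> objs C" "N \<in> objs C"
    using k src_in[of k] tgt_in[of k] by (auto simp: hom_iff)
  have [simp]: "A \<in> objs C" "D \<in> objs C" "\<mu> \<in> arrs C" "src C \<mu> = A \<odot> A" "tgt C \<mu> = A"
    "\<delta> \<in> arrs C" "src C \<delta> = D" "tgt C \<delta> = D \<odot> D"
    "k \<in> arrs C" "src C k = M" "tgt C k = N" "g \<in> arrs C" "src C g = D" "tgt C g = A"
    "F \<in> arrs C" "src C F = D \<odot> N" "tgt C F = A"
    using assms by (auto simp: hom_iff)
  have "(\<delta> \<otimes> \<one> N) \<cdot> (\<one> D \<otimes> k) = (\<one> D \<otimes> \<one> D \<otimes> k) \<cdot> (\<delta> \<otimes> \<one> M)"
    by (simp add: merges)
  then show ?thesis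
    using merge_cmp[of "\<one> D" g "\<one> D \<otimes> k" F "\<delta> \<otimes> \<one> M"] by (simp add: conv_def)
qed

section \<open>Hopf algebras and coalgebra morphisms\<close>

lemma hopf_algebraD:
  assumes "hopf_algebra C X"
  shows "algebra C (carr X, unit X, mult X)" "coalgebra C (carr X, counit X, comult X)"
    "antipode X \<in> hom C (carr X) (carr X)"
  using assms by (simp_all add: hopf_algebra_def alg_def coalg_def)

text \<open>The antipode axioms precomposed with \<open>f\<close>: comultiplicativity produces the
  two copies of \<open>f\<close>, and counitality turns \<open>counit X \<cdot> f\<close> into
  \<open>\<epsilon>\<close>.\<close>

lemma antipode_conv_inverse:
  assumes X: "hopf_algebra C X"
    and f: "coalgebra_morphism C (D, \<epsilon>, \<delta>) (coalg X) f" and D: "\<delta> \<in> hom C D (D \<odot> D)"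
  shows "mult X \<cdot> ((antipode X \<cdot> f) \<otimes> f) \<cdot> \<delta> = unit X \<cdot> \<epsilon>"
    and "mult X \<cdot> (f \<otimes> (antipode X \<cdot> f)) \<cdot> \<delta> = unit X \<cdot> \<epsilon>"
proof -
  let ?S = "antipode X" and ?X = "carr X" and ?\<mu> = "mult X"
  have [simp]: "?X \<in> objs C" "?\<mu> \<in> arrs C" "src C ?\<mu> = ?X \<odot> ?X" "tgt C ?\<mu> = ?X"
    "comult X \<in> arrs C" "src C (comult X) = ?X" "tgt C (comult X) = ?X \<odot> ?X"
    "unit X \<in> arrs C" "src C (unit X) = \<K>" "tgt C (unit X) = ?X"
    "counit X \<in> arrs C" "src C (counit X) = ?X" "tgt C (counit X) = \<K>"
    "\<delta> \<in> arrs C" "src C \<delta> = D" "tgt C \<delta> = D \<odot> D"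
    "f \<in> arrs C" "src C f = D" "tgt C f = ?X" "?S \<in> arrs C" "src C ?S = ?X" "tgt C ?S = ?X"
    and f_comult: "comult X \<cdot> f = (f \<otimes> f) \<cdot> \<delta>" and f_counit: "counit X \<cdot> f = \<epsilon>"
    and S: "?\<mu> \<cdot> (\<one> ?X \<otimes> ?S) \<cdot> comult X = unit X \<cdot> counit X"
      "?\<mu> \<cdot> (?S \<otimes> \<one> ?X) \<cdot> comult X = unit X \<cdot> counit X"
    using assms by (auto simp: hopf_algebra_def alg_def coalg_def hom_iff)
  have [simp]: "D \<in> objs C"
    using src_in[of f] by simp
  have "?\<mu> \<cdot> ((?S \<cdot> f) \<otimes> f) \<cdot> \<delta> = ?\<mu> \<cdot> (?S \<otimes> \<one> ?X) \<cdot> (f \<otimes> f) \<cdot> \<delta>"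
    by (simp add: merges)
  also have "\<dots> = (?\<mu> \<cdot> (?S \<otimes> \<one> ?X) \<cdot> comult X) \<cdot> f"
    using f_comult by simp
  finally show "?\<mu> \<cdot> ((?S \<cdot> f) \<otimes> f) \<cdot> \<delta> = unit X \<cdot> \<epsilon>"
    unfolding S using f_counit by simp
  have "?\<mu> \<cdot> (f \<otimes> (?S \<cdot> f)) \<cdot> \<delta> = ?\<mu> \<cdot> (\<one> ?X \<otimes> ?S) \<cdot> (f \<otimes> f) \<cdot> \<delta>"
    by (simp add: merges)
  also have "\<dots> = (?\<mu> \<cdot> (\<one> ?X \<otimes> ?S) \<cdot> comult X) \<cdot> f"
    using f_comult by simp
  finally show "?\<mu> \<cdot> (f \<otimes> (?S \<cdot> f)) \<cdot> \<delta> = unit X \<cdot> \<epsilon>"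
    unfolding S using f_counit by simp
qed

text \<open>The bialgebra axioms are self-dual: the equations making counit and comultiplication
  algebra morphisms also make unit and multiplication coalgebra morphisms.\<close>

lemma unit_coalgebra_map:
  assumes X: "hopf_algebra C X"
  shows "coalgebra_morphism C (\<K>, \<one> \<K>, \<one> \<K>) (coalg X) (unit X)"
  using X by (simp add: hopf_algebra_def alg_def coalg_def unit_algebra_def hom_iff)

lemma mult_coalgebra_map:
  assumes X: "hopf_algebra C X"
  shows "coalgebra_morphism C (tensor_coalgebra C (coalg X) (coalg X)) (coalg X) (mult X)"
  using X by (simp add: hopf_algebra_def alg_def coalg_def unit_algebra_def hom_iff)

lemma coalgebra_map_comp:
  assumes f: "coalgebra_morphism C (D, \<epsilon>\<^sub>D, \<delta>\<^sub>D) (E, \<epsilon>\<^sub>E, \<delta>\<^sub>E) f"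
    and g: "coalgebra_morphism C (E, \<epsilon>\<^sub>E, \<delta>\<^sub>E) (F, \<epsilon>\<^sub>F, \<delta>\<^sub>F) g"
    and D: "\<delta>\<^sub>D \<in> hom C D (D \<odot> D)" and E: "\<delta>\<^sub>E \<in> hom C E (E \<odot> E)"
    and F: "\<epsilon>\<^sub>F \<in> hom C F \<K>" "\<delta>\<^sub>F \<in> hom C F (F \<odot> F)"
  shows "coalgebra_morphism C (D, \<epsilon>\<^sub>D, \<delta>\<^sub>D) (F, \<epsilon>\<^sub>F, \<delta>\<^sub>F) (g \<cdot> f)"
proof -
  have [simp]: "f \<in> arrs C" "src C f = D" "tgt C f = E" "g \<in> arrs C" "src C g = E" "tgt C g = F"
    "\<delta>\<^sub>D \<in> arrs C" "src C \<delta>\<^sub>D = D" "tgt C \<delta>\<^sub>D = D \<odot> D"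
    "\<delta>\<^sub>E \<in> arrs C" "src C \<delta>\<^sub>E = E" "tgt C \<delta>\<^sub>E = E \<odot> E"
    "\<delta>\<^sub>F \<in> arrs C" "src C \<delta>\<^sub>F = F" "tgt C \<delta>\<^sub>F = F \<odot> F"
    "\<epsilon>\<^sub>F \<in> arrs C" "src C \<epsilon>\<^sub>F = F" "tgt C \<epsilon>\<^sub>F = \<K>"
    and f_map: "\<epsilon>\<^sub>E \<cdot> f = \<epsilon>\<^sub>D" "\<delta>\<^sub>E \<cdot> f = (f \<otimes> f) \<cdot> \<delta>\<^sub>D"
    and g_map: "\<epsilon>\<^sub>F \<cdot> g = \<epsilon>\<^sub>E" "\<delta>\<^sub>F \<cdot> g = (g \<otimes> g) \<cdot> \<delta>\<^sub>E"
    using assms by (auto simp: hom_iff)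
  have "\<epsilon>\<^sub>F \<cdot> g \<cdot> f = (\<epsilon>\<^sub>F \<cdot> g) \<cdot> f" "\<delta>\<^sub>F \<cdot> g \<cdot> f = (\<delta>\<^sub>F \<cdot> g) \<cdot> f"
    by simp_all
  then show ?thesis
    unfolding g_map using f_map by (simp add: hom_iff merge_cmp)
qed

text \<open>Following this map by \<open>\<phi>\<close> gives \<open>u\<close>. It respects
  coproducts because the unit is group-like and passes through the braiding, a braiding with
  \<open>\<K>\<close> being trivial.\<close>

lemma tensor_unit_coalgebra_map:
  assumes D: "coalgebra C (D, \<epsilon>, \<delta>)" and X: "hopf_algebra C X"
  shows "coalgebra_morphism C (D, \<epsilon>, \<delta>) (tensor_coalgebra C (D, \<epsilon>, \<delta>) (coalg X)) (\<one> D \<otimes> unit X)"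
proof -
  let ?X = "carr X" and ?\<eta> = "unit X"
  have [simp]: "?X \<in> objs C" "D \<in> objs C"
    "\<delta> \<in> arrs C" "src C \<delta> = D" "tgt C \<delta> = D \<odot> D" "\<epsilon> \<in> arrs C" "src C \<epsilon> = D" "tgt C \<epsilon> = \<K>"
    "comult X \<in> arrs C" "src C (comult X) = ?X" "tgt C (comult X) = ?X \<odot> ?X"
    "?\<eta> \<in> arrs C" "src C ?\<eta> = \<K>" "tgt C ?\<eta> = ?X"
    "counit X \<in> arrs C" "src C (counit X) = ?X" "tgt C (counit X) = \<K>"
    and unit: "counit X \<cdot> ?\<eta> = \<one> \<K>" "comult X \<cdot> ?\<eta> = ?\<eta> \<otimes> ?\<eta>"
    using D X hopf_algebraD[OF X] unit_coalgebra_map[OF X] by (auto simp: coalg_def hom_iff)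
  have nat: "braid C D ?X \<cdot> (\<one> D \<otimes> ?\<eta>) = ?\<eta> \<otimes> \<one> D"
    using braid_natural'[of "\<one> D" ?\<eta> D \<K> D ?X] by simp
  have split: "\<delta> \<otimes> ?\<eta> \<otimes> ?\<eta> = (\<one> D \<otimes> \<one> D \<otimes> ?\<eta> \<otimes> ?\<eta>) \<cdot> \<delta>"
    using merge[of \<delta> "\<one> D \<otimes> \<one> D" "\<one> \<K>" "?\<eta> \<otimes> ?\<eta>"] by (simp add: ident_tens_cmp)
  have "((\<one> D \<otimes> braid C D ?X \<otimes> \<one> ?X) \<cdot> (\<delta> \<otimes> comult X)) \<cdot> (\<one> D \<otimes> ?\<eta>)
      = (\<one> D \<otimes> braid C D ?X \<otimes> \<one> ?X) \<cdot> (\<delta> \<otimes> (comult X \<cdot> ?\<eta>))"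
    by (simp add: merges)
  also have "\<dots> = (\<one> D \<otimes> (braid C D ?X \<cdot> (\<one> D \<otimes> ?\<eta>)) \<otimes> ?\<eta>) \<cdot> \<delta>"
    unfolding unit split by (simp add: merges)
  also have "\<dots> = (\<one> D \<otimes> ?\<eta> \<otimes> \<one> D \<otimes> ?\<eta>) \<cdot> \<delta>"
    unfolding nat by simp
  finally show ?thesis
    using merge[of "\<one> D" \<epsilon> ?\<eta> "counit X"] by (simp add: coalg_def hom_iff unit)
qed

section \<open>Hopf bracoids\<close>

context
  fixes H B :: "('a, 'b) hopf_data" and \<phi> :: 'b
  assumes bracoid: "hopf_bracoid C H B \<phi>"
    and \<phi>_coalgebra_map: "coalgebra_morphism C (tensor_coalgebra C (coalg H) (coalg B)) (coalg B) \<phi>"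
begin

private abbreviation "h \<equiv> carr H"
private abbreviation "b \<equiv> carr B"
private abbreviation "u \<equiv> bracoid_u C H B \<phi>"
private abbreviation "\<Phi> \<equiv> bracoid_Phi C H B \<phi>"
private abbreviation "S \<equiv> antipode B"
private abbreviation "c \<equiv> braid C h b"

lemma hopf: "hopf_algebra C H" "hopf_algebra C B"
  using bracoid by (simp_all add: hopf_bracoid_def)

lemmas H_laws = hopf_algebraD(1,2)[OF hopf(1)]
lemmas B_laws = hopf_algebraD[OF hopf(2)]

lemma bracoid_arr [simp]:
  "h \<in> objs C" "b \<in> objs C"
  "unit H \<in> arrs C" "src C (unit H) = \<K>" "tgt C (unit H) = h"
  "counit H \<in> arrs C" "src C (counit H) = h" "tgt C (counit H) = \<K>"
  "mult H \<in> arrs C" "src C (mult H) = h \<odot> h" "tgt C (mult H) = h"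
  "comult H \<in> arrs C" "src C (comult H) = h" "tgt C (comult H) = h \<odot> h"
  "unit B \<in> arrs C" "src C (unit B) = \<K>" "tgt C (unit B) = b"
  "counit B \<in> arrs C" "src C (counit B) = b" "tgt C (counit B) = \<K>"
  "mult B \<in> arrs C" "src C (mult B) = b \<odot> b" "tgt C (mult B) = b"
  "comult B \<in> arrs C" "src C (comult B) = b" "tgt C (comult B) = b \<odot> b"
  "S \<in> arrs C" "src C S = b" "tgt C S = b"
  "\<phi> \<in> arrs C" "src C \<phi> = h \<odot> b" "tgt C \<phi> = b"
  using H_laws B_laws bracoid by (auto simp: hopf_bracoid_def left_module_def hom_iff)

lemma u_arr [simp]: "u \<in> arrs C" "src C u = h" "tgt C u = b"
  by (simp_all add: bracoid_u_def)

lemma Phi_arr [simp]: "\<Phi> \<in> arrs C" "src C \<Phi> = h \<odot> b" "tgt C \<Phi> = b"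
  by (simp_all add: bracoid_Phi_def)

lemma module_\<phi>:
  "\<phi> \<cdot> (unit H \<otimes> \<one> b) = \<one> b" "\<phi> \<cdot> (\<one> h \<otimes> \<phi>) = \<phi> \<cdot> (mult H \<otimes> \<one> b)"
  using bracoid by (simp_all add: hopf_bracoid_def left_module_def)

lemma \<phi>_mult:
  "\<phi> \<cdot> (\<one> h \<otimes> mult B) =
    mult B \<cdot> (\<phi> \<otimes> \<Phi>) \<cdot> (\<one> h \<otimes> c \<otimes> \<one> b) \<cdot> (comult H \<otimes> \<one> b \<otimes> \<one> b)"
  using bracoid by (simp add: hopf_bracoid_def)

section \<open>The convolution relation between \<open>\<phi>\<close> and \<open>\<Phi>\<close>, and
  the laws it yields\<close>

lemma Phi_conv: "\<Phi> = conv (mult B) (comult H) b (S \<cdot> u) \<phi>"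
  by (simp add: bracoid_Phi_def conv_def)

text \<open>The hypothesis that \<open>\<phi>\<close> is a coalgebra morphism enters here; later
  arguments draw on it through \<open>u\<close>.\<close>

lemma u_coalgebra_map: "coalgebra_morphism C (coalg H) (coalg B) u"
  unfolding bracoid_u_def coalg_def
proof (rule coalgebra_map_comp)
  show "coalgebra_morphism C (h, counit H, comult H)
      (h \<odot> b, counit H \<otimes> counit B, (\<one> h \<otimes> c \<otimes> \<one> b) \<cdot> (comult H \<otimes> comult B)) (\<one> h \<otimes> unit B)"
    using tensor_unit_coalgebra_map[OF H_laws(2) hopf(2)] by (simp add: coalg_def)
  show "coalgebra_morphism C
      (h \<odot> b, counit H \<otimes> counit B, (\<one> h \<otimes> c \<otimes> \<one> b) \<cdot> (comult H \<otimes> comult B))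
      (b, counit B, comult B) \<phi>"
    using \<phi>_coalgebra_map by (simp add: coalg_def)
qed (simp_all add: hom_iff)

text \<open>Inverts the definition of \<open>\<Phi>\<close>, using that \<open>S \<cdot> u\<close>
  is a right convolution inverse of \<open>u\<close>.\<close>

lemma conv_u_Phi: "conv (mult B) (comult H) b u \<Phi> = \<phi>"
  unfolding Phi_conv
  by (rule conv_cancel[OF B_laws(1) H_laws(2)])
    (simp_all add: hom_iff antipode_conv_inverse[OF hopf(2) u_coalgebra_map[unfolded coalg_def[of H]]])

text \<open>Inserting the unit turns \<open>\<phi>\<close> into \<open>u\<close>. What remains is
  the convolution product of \<open>S \<cdot> u\<close> and \<open>u\<close>, which is
  trivial.\<close>

lemma Phi_unit: "\<Phi> \<cdot> (\<one> h \<otimes> unit B) = counit H \<otimes> unit B"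
proof -
  have "\<Phi> \<cdot> (\<one> h \<otimes> unit B) = conv (mult B) (comult H) \<K> (S \<cdot> u) u"
    unfolding Phi_conv
    by (subst conv_comp_right[OF B_laws(1) H_laws(2)]) (simp_all add: hom_iff bracoid_u_def)
  also have "\<dots> = unit B \<cdot> counit H"
    using antipode_conv_inverse(1)[OF hopf(2) u_coalgebra_map[unfolded coalg_def[of H]]]
    by (simp add: conv_def hom_iff)
  also have "\<dots> = counit H \<otimes> unit B"
    using merge[of "counit H" "\<one> \<K>" "\<one> \<K>" "unit B"] by simp
  finally show ?thesis .
qed

text \<open>The unit is a coalgebra morphism from \<open>\<K>\<close>, where the antipode equation
  reads \<open>S(1) 1 = 1\<close>.\<close>

lemma antipode_unit: "S \<cdot> unit B = unit B"
proof -
  have "unit B = mult B \<cdot> ((S \<cdot> unit B) \<otimes> unit B)"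
    using antipode_conv_inverse(1)[OF hopf(2) unit_coalgebra_map[OF hopf(2)]] by (simp add: hom_iff)
  also have "\<dots> = (mult B \<cdot> (\<one> b \<otimes> unit B)) \<cdot> S \<cdot> unit B"
    using merge[of "S \<cdot> unit B" "\<one> b" "\<one> \<K>" "unit B"] by simp
  also have "mult B \<cdot> (\<one> b \<otimes> unit B) = \<one> b"
    using B_laws(1) by simp
  finally show ?thesis
    by simp
qed

text \<open>Restricting the convolution along \<open>unit H\<close> replaces \<open>\<phi>\<close>
  by the identity and \<open>S \<cdot> u\<close> by the unit of \<open>B\<close>.\<close>

lemma Phi_unit_action: "\<Phi> \<cdot> (unit H \<otimes> \<one> b) = \<one> b"
proof -
  \<comment> \<open>The tensor product of the two units is factored in both orders.\<close>
  have "u \<cdot> unit H = \<phi> \<cdot> (unit H \<otimes> \<one> b) \<cdot> unit B"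
    using merge[of "unit H" "\<one> h" "\<one> \<K>" "unit B"] merge[of "\<one> \<K>" "unit H" "unit B" "\<one> b"]
    by (simp add: bracoid_u_def)
  then have u: "u \<cdot> unit H = unit B"
    using module_\<phi>(1) by (simp flip: assoc)
  have "\<Phi> \<cdot> (unit H \<otimes> \<one> b)
      = conv (mult B) (\<one> \<K>) b ((S \<cdot> u) \<cdot> unit H) (\<phi> \<cdot> (unit H \<otimes> \<one> b))"
    unfolding Phi_conv
    by (rule conv_comp_coalgebra_map[OF B_laws(1) H_laws(2) _ unit_coalgebra_map[OF hopf(1), unfolded coalg_def]])
      (simp_all add: hom_iff)
  also have "\<dots> = conv (mult B) (\<one> \<K>) b (unit B) (\<one> b)"
    by (simp add: u module_\<phi> antipode_unit)
  also have "\<dots> = \<one> b"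
    using B_laws(1) by (simp add: conv_def)
  finally show ?thesis .
qed

text \<open>The two sides of the module law for \<open>\<phi>\<close> become convolutions over
  \<open>h \<odot> h\<close> with the same first factor: the bracoid identity handles one side, base
  change along \<open>mult H\<close> the other.\<close>

lemma Phi_mult_action: "\<Phi> \<cdot> (\<one> h \<otimes> \<Phi>) = \<Phi> \<cdot> (mult H \<otimes> \<one> b)"
proof -
  define \<Delta> where "\<Delta> = (\<one> h \<otimes> braid C h h \<otimes> \<one> h) \<cdot> (comult H \<otimes> comult H)"
  have \<Delta> [simp]: "\<Delta> \<in> arrs C" "src C \<Delta> = h \<odot> h" "tgt C \<Delta> = h \<odot> h \<odot> h \<odot> h"
    by (simp_all add: \<Delta>_def)
  have HH: "coalgebra C (h \<odot> h, counit H \<otimes> counit H, \<Delta>)"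
    using tensor_coalgebra_coalgebra[OF H_laws(2) H_laws(2)] by (simp add: \<Delta>_def)
  have mult_map: "coalgebra_morphism C (h \<odot> h, counit H \<otimes> counit H, \<Delta>) (h, counit H, comult H) (mult H)"
    using mult_coalgebra_map[OF hopf(1)] by (simp add: coalg_def \<Delta>_def)
  have u_mult_map: "coalgebra_morphism C (h \<odot> h, counit H \<otimes> counit H, \<Delta>) (coalg B) (u \<cdot> mult H)"
    unfolding coalg_def
    by (rule coalgebra_map_comp[OF mult_map u_coalgebra_map[unfolded coalg_def]])
      (simp_all add: hom_iff)
  let ?conv = "conv (mult B) \<Delta> b (u \<cdot> mult H)"
  have cancel: "conv (mult B) \<Delta> b (S \<cdot> u \<cdot> mult H) (?conv F) = F" if "F \<in> hom C (h \<odot> h \<odot> b) b" for F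
    by (rule conv_cancel[OF B_laws(1) HH])
      (use that in \<open>simp_all add: hom_iff antipode_conv_inverse(1)[OF hopf(2) u_mult_map]\<close>)
  \<comment> \<open>The module law for \<open>\<phi>\<close> evaluated at the unit of
    \<open>B\<close>.\<close>
  have u_mult: "u \<cdot> mult H = \<phi> \<cdot> (\<one> h \<otimes> u)"
  proof -
    have "\<phi> \<cdot> (\<one> h \<otimes> u) = (\<phi> \<cdot> (\<one> h \<otimes> \<phi>)) \<cdot> (\<one> h \<otimes> \<one> h \<otimes> unit B)"
      by (simp add: bracoid_u_def merges)
    also have "\<dots> = u \<cdot> mult H"
      unfolding module_\<phi> using merge[of "mult H" "\<one> h" "\<one> \<K>" "unit B"]
      by (simp add: bracoid_u_def merges)
    finally show ?thesis ..
  qed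
  have right: "\<phi> \<cdot> (mult H \<otimes> \<one> b) = ?conv (\<Phi> \<cdot> (mult H \<otimes> \<one> b))"
    using conv_comp_coalgebra_map[OF B_laws(1) H_laws(2) _ mult_map, of b u \<Phi>] conv_u_Phi
    by (simp add: hom_iff)
  \<comment> \<open>Sliding \<open>u\<close> through the braiding of \<open>h\<close> with
    \<open>b\<close> yields the braiding of \<open>h\<close> with itself that occurs in
    \<open>\<Delta>\<close>.\<close>
  have nat: "c \<cdot> (\<one> h \<otimes> u) = (u \<otimes> \<one> h) \<cdot> braid C h h"
    using braid_natural'[of "\<one> h" u h h h b] by simp
  have "\<phi> \<cdot> (\<one> h \<otimes> \<phi>) = \<phi> \<cdot> (\<one> h \<otimes> conv (mult B) (comult H) b u \<Phi>)"
    by (simp add: conv_u_Phi)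
  also have "\<dots> = (\<phi> \<cdot> (\<one> h \<otimes> mult B)) \<cdot> (\<one> h \<otimes> u \<otimes> \<Phi>) \<cdot> (\<one> h \<otimes> comult H \<otimes> \<one> b)"
    by (simp add: conv_def merges)
  \<comment> \<open>The bracoid identity applies because \<open>\<phi>\<close>, written as
    \<open>u * \<Phi>\<close>, ends in \<open>mult B\<close>. The coproduct it creates is then
    merged with the one from the convolution.\<close>
  also have "\<dots> = mult B \<cdot> (\<phi> \<otimes> \<Phi>) \<cdot> (\<one> h \<otimes> (c \<cdot> (\<one> h \<otimes> u)) \<otimes> \<Phi>) \<cdot> (comult H \<otimes> comult H \<otimes> \<one> b)"
  proof -
    have "(comult H \<otimes> \<one> b \<otimes> \<one> b) \<cdot> (\<one> h \<otimes> u \<otimes> \<Phi>) \<cdot> (\<one> h \<otimes> comult H \<otimes> \<one> b)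
        = (\<one> h \<otimes> \<one> h \<otimes> u \<otimes> \<Phi>) \<cdot> (comult H \<otimes> comult H \<otimes> \<one> b)"
      and "\<one> h \<otimes> (c \<cdot> (\<one> h \<otimes> u)) \<otimes> \<Phi> = (\<one> h \<otimes> c \<otimes> \<one> b) \<cdot> (\<one> h \<otimes> \<one> h \<otimes> u \<otimes> \<Phi>)"
      by (simp_all add: merges)
    then show ?thesis
      unfolding \<phi>_mult by simp
  qed
  also have "\<dots> = mult B \<cdot> ((\<phi> \<cdot> (\<one> h \<otimes> u)) \<otimes> (\<Phi> \<cdot> (\<one> h \<otimes> \<Phi>))) \<cdot> (\<Delta> \<otimes> \<one> b)"
  proof -
    have "\<one> h \<otimes> ((u \<otimes> \<one> h) \<cdot> braid C h h) \<otimes> \<Phi>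
        = (\<one> h \<otimes> u \<otimes> \<one> h \<otimes> \<Phi>) \<cdot> (\<one> h \<otimes> braid C h h \<otimes> \<one> h \<otimes> \<one> b)"
      and "(\<phi> \<cdot> (\<one> h \<otimes> u)) \<otimes> (\<Phi> \<cdot> (\<one> h \<otimes> \<Phi>)) = (\<phi> \<otimes> \<Phi>) \<cdot> (\<one> h \<otimes> u \<otimes> \<one> h \<otimes> \<Phi>)"
      by (simp_all add: merges)
    moreover have "\<Delta> \<otimes> \<one> b = (\<one> h \<otimes> braid C h h \<otimes> \<one> h \<otimes> \<one> b) \<cdot> (comult H \<otimes> comult H \<otimes> \<one> b)"
      using merge[of "comult H \<otimes> comult H" "\<one> h \<otimes> braid C h h \<otimes> \<one> h" "\<one> b" "\<one> b"]
      by (simp add: \<Delta>_def)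
    ultimately show ?thesis
      unfolding nat by simp
  qed
  also have "\<dots> = ?conv (\<Phi> \<cdot> (\<one> h \<otimes> \<Phi>))"
    by (simp add: conv_def u_mult)
  finally have left: "\<phi> \<cdot> (\<one> h \<otimes> \<phi>) = ?conv (\<Phi> \<cdot> (\<one> h \<otimes> \<Phi>))" .
  have hom: "\<Phi> \<cdot> (\<one> h \<otimes> \<Phi>) \<in> hom C (h \<odot> h \<odot> b) b" "\<Phi> \<cdot> (mult H \<otimes> \<one> b) \<in> hom C (h \<odot> h \<odot> b) b"
    by (simp_all add: hom_iff)
  have "?conv (\<Phi> \<cdot> (\<one> h \<otimes> \<Phi>)) = ?conv (\<Phi> \<cdot> (mult H \<otimes> \<one> b))"
    by (rule trans[OF left[symmetric] trans[OF module_\<phi>(2) right]])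
  with cancel[OF hom(1)] cancel[OF hom(2)] show ?thesis
    by argo
qed

text \<open>Let \<open>S \<cdot> u\<close> act on the bracoid identity. Associativity and
  coassociativity attach it to the first factor \<open>\<phi>\<close>, which thereby becomes
  \<open>\<Phi>\<close>; the second factor is \<open>\<Phi>\<close> already.\<close>

lemma Phi_mult:
  "\<Phi> \<cdot> (\<one> h \<otimes> mult B) =
    mult B \<cdot> (\<Phi> \<otimes> \<Phi>) \<cdot> (\<one> h \<otimes> c \<otimes> \<one> b) \<cdot> (comult H \<otimes> \<one> b \<otimes> \<one> b)"
proof -
  have assoc_B: "mult B \<cdot> (mult B \<otimes> \<one> b) = mult B \<cdot> (\<one> b \<otimes> mult B)"
    and coassoc: "(comult H \<otimes> \<one> h) \<cdot> comult H = (\<one> h \<otimes> comult H) \<cdot> comult H"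
    using B_laws(1) H_laws(2) by simp_all
  have "\<Phi> \<cdot> (\<one> h \<otimes> mult B) = conv (mult B) (comult H) (b \<odot> b) (S \<cdot> u) (\<phi> \<cdot> (\<one> h \<otimes> mult B))"
    unfolding Phi_conv
    by (rule conv_comp_right[OF B_laws(1) H_laws(2)]) (simp_all add: hom_iff)
  also have "\<dots> = (mult B \<cdot> (\<one> b \<otimes> mult B)) \<cdot> ((S \<cdot> u) \<otimes> \<phi> \<otimes> \<Phi>) \<cdot>
      (\<one> h \<otimes> \<one> h \<otimes> c \<otimes> \<one> b) \<cdot> (((\<one> h \<otimes> comult H) \<cdot> comult H) \<otimes> \<one> b \<otimes> \<one> b)"
  proof -
    have "(S \<cdot> u) \<otimes> (mult B \<cdot> (\<phi> \<otimes> \<Phi>) \<cdot> (\<one> h \<otimes> c \<otimes> \<one> b) \<cdot> (comult H \<otimes> \<one> b \<otimes> \<one> b))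
        = (\<one> b \<otimes> mult B) \<cdot> ((S \<cdot> u) \<otimes> \<phi> \<otimes> \<Phi>) \<cdot>
          (\<one> h \<otimes> \<one> h \<otimes> c \<otimes> \<one> b) \<cdot> (\<one> h \<otimes> comult H \<otimes> \<one> b \<otimes> \<one> b)"
      and "((\<one> h \<otimes> comult H) \<cdot> comult H) \<otimes> \<one> b \<otimes> \<one> b
        = (\<one> h \<otimes> comult H \<otimes> \<one> b \<otimes> \<one> b) \<cdot> (comult H \<otimes> \<one> b \<otimes> \<one> b)"
      by (simp_all add: merges)
    then show ?thesis
      unfolding \<phi>_mult by (simp add: conv_def tens_ident[symmetric])
  qed
  also have "\<dots> = (mult B \<cdot> (mult B \<otimes> \<one> b)) \<cdot> ((S \<cdot> u) \<otimes> \<phi> \<otimes> \<Phi>) \<cdot>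
      (\<one> h \<otimes> \<one> h \<otimes> c \<otimes> \<one> b) \<cdot> (((comult H \<otimes> \<one> h) \<cdot> comult H) \<otimes> \<one> b \<otimes> \<one> b)"
    by (simp only: assoc_B coassoc)
  also have "\<dots> = mult B \<cdot> (conv (mult B) (comult H) b (S \<cdot> u) \<phi> \<otimes> \<Phi>) \<cdot>
      (\<one> h \<otimes> c \<otimes> \<one> b) \<cdot> (comult H \<otimes> \<one> b \<otimes> \<one> b)"
  proof -
    have "conv (mult B) (comult H) b (S \<cdot> u) \<phi> \<otimes> \<Phi>
        = (mult B \<otimes> \<one> b) \<cdot> ((S \<cdot> u) \<otimes> \<phi> \<otimes> \<Phi>) \<cdot> (comult H \<otimes> \<one> b \<otimes> \<one> h \<otimes> \<one> b)"
      and slide: "(comult H \<otimes> \<one> b \<otimes> \<one> h \<otimes> \<one> b) \<cdot> (\<one> h \<otimes> c \<otimes> \<one> b)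
        = (\<one> h \<otimes> \<one> h \<otimes> c \<otimes> \<one> b) \<cdot> (comult H \<otimes> \<one> h \<otimes> \<one> b \<otimes> \<one> b)"
      and "((comult H \<otimes> \<one> h) \<cdot> comult H) \<otimes> \<one> b \<otimes> \<one> b
        = (comult H \<otimes> \<one> h \<otimes> \<one> b \<otimes> \<one> b) \<cdot> (comult H \<otimes> \<one> b \<otimes> \<one> b)"
      by (simp_all add: conv_def merges)
    \<comment> \<open>\<open>slide\<close> commutes a coproduct with a braiding on other strands.
      This version carries the tail that right-nesting places behind it.\<close>
    moreover have "(comult H \<otimes> \<one> b \<otimes> \<one> h \<otimes> \<one> b) \<cdot> (\<one> h \<otimes> c \<otimes> \<one> b) \<cdot> (comult H \<otimes> \<one> b \<otimes> \<one> b)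
        = (\<one> h \<otimes> \<one> h \<otimes> c \<otimes> \<one> b) \<cdot> (comult H \<otimes> \<one> h \<otimes> \<one> b \<otimes> \<one> b) \<cdot> (comult H \<otimes> \<one> b \<otimes> \<one> b)"
      using arg_cong[OF slide, of "\<lambda>x. x \<cdot> (comult H \<otimes> \<one> b \<otimes> \<one> b)"] by simp
    ultimately show ?thesis
      by simp
  qed
  finally show ?thesis
    by (simp only: Phi_conv[symmetric])
qed

lemma Phi_module_algebra: "left_module_algebra C H (alg B) \<Phi>"
  using hopf(1) B_laws(1) Phi_unit Phi_unit_action Phi_mult_action Phi_mult
  by (simp add: alg_def left_module_def hom_iff)

end

end

theorem theorem2p19:
  fixes C :: "('o, 'm) braided_data"
    and H B :: "('o, 'm) hopf_data"
    and \<phi> :: "'m"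
  assumes "strict_braided_monoidal_category C"
    and "hopf_bracoid C H B \<phi>"
    and "coalgebra_morphism C (tensor_coalgebra C (coalg H) (coalg B)) (coalg B) \<phi>"
  shows "left_module_algebra C H (alg B) (bracoid_Phi C H B \<phi>)"
  using strict_braided_monoidal_category.Phi_module_algebra[OF assms] .

end
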